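(* Let $G$ be a group and let $X$ be an infinite transitive $G$-space. A subset $A$ of $X$ is sparse if and only if $\bigtriangleup_p(A)$ is finite for each $p\in X^*$.
   Context: $[G]^{<\omega}$ is the family of all finite subsets of $G$. For $F\in[G]^{<\omega}$ and $x\in X$, $B(x,F)=Fx\cup\{x\}$, where $Fx=\{gx:g\in F\}$; for $Y\subseteq X$ and $y\in Y$, $B_Y(y,F)=B(y,F)\cap Y$. A subset $A$ of $X$ is sparse if, for every infinite subset $Y$ of $A$, there exists $H\in[G]^{<\omega}$ such that, for every $F\in[G]^{<\omega}$, there is $y\in Y$ such that $B_A(y,F)\setminus B_A(y,H)=\varnothing$. $\beta X$ is the space of ultrafilters on the discrete space $X$, with points of $X$ identified with principal ultrafilters; $X^*=\beta X\setminus X$. For $g\in G$ and $p\in\beta X$, $gp=\{gP:P\in p\}$. For $A\subseteq X$ and $p\in X^*$, $\bigtriangleup_p(A)=\{gp: g\in G, A\in gp\}$. *)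

theory Defs
  imports "HOL-Algebra.Group_Action"
begin

definition ball_at :: "('g \<Rightarrow> 'x \<Rightarrow> 'x) \<Rightarrow> 'x \<Rightarrow> 'g set \<Rightarrow> 'x set" where
  "ball_at \<phi> x F = (\<lambda>g. \<phi> g x) ` F \<union> {x}"

definition ball_in :: "('g \<Rightarrow> 'x \<Rightarrow> 'x) \<Rightarrow> 'x set \<Rightarrow> 'x \<Rightarrow> 'g set \<Rightarrow> 'x set" where
  "ball_in \<phi> Y y F = ball_at \<phi> y F \<inter> Y"

definition sparse :: "('g, 'm) monoid_scheme \<Rightarrow> ('g \<Rightarrow> 'x \<Rightarrow> 'x) \<Rightarrow> 'x set \<Rightarrow> bool" where
  "sparse G \<phi> A \<longleftrightarrow>
     (\<forall>Y. Y \<subseteq> A \<and> infinite Y \<longrightarrow>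
       (\<exists>H \<in> Fpow (carrier G). \<forall>F \<in> Fpow (carrier G). \<exists>y \<in> Y.
          ball_in \<phi> A y F - ball_in \<phi> A y H = {}))"

text \<open>Ultrafilters on a carrier set \<open>X\<close> are represented as families of subsets of \<open>X\<close>,
  so that the translate of \<open>p\<close> by \<open>g\<close> is literally the family of translated members.\<close>

definition ultrafilter_on :: "'x set \<Rightarrow> 'x set set \<Rightarrow> bool" where
  "ultrafilter_on X p \<longleftrightarrow>
     p \<subseteq> Pow X \<and> X \<in> p \<and> {} \<notin> p \<and>
     (\<forall>P \<in> p. \<forall>Q \<in> p. P \<inter> Q \<in> p) \<and>
     (\<forall>P \<in> p. \<forall>Q. P \<subseteq> Q \<and> Q \<subseteq> X \<longrightarrow> Q \<in> p) \<and>
     (\<forall>P. P \<subseteq> X \<longrightarrow> P \<in> p \<or> X - P \<in> p)"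

definition beta :: "'x set \<Rightarrow> 'x set set set" where
  "beta X = {p. ultrafilter_on X p}"

definition principal_ultrafilter :: "'x set \<Rightarrow> 'x \<Rightarrow> 'x set set" where
  "principal_ultrafilter X x = {P. P \<subseteq> X \<and> x \<in> P}"

definition beta_remainder :: "'x set \<Rightarrow> 'x set set set" where
  "beta_remainder X = beta X - principal_ultrafilter X ` X"

definition translate :: "('g \<Rightarrow> 'x \<Rightarrow> 'x) \<Rightarrow> 'g \<Rightarrow> 'x set set \<Rightarrow> 'x set set" where
  "translate \<phi> g p = {\<phi> g ` P | P. P \<in> p}"

definition ultra_companion ::
  "('g, 'm) monoid_scheme \<Rightarrow> ('g \<Rightarrow> 'x \<Rightarrow> 'x) \<Rightarrow> 'x set set \<Rightarrow> 'x set \<Rightarrow> 'x set set set" where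
  "ultra_companion G \<phi> p A = {translate \<phi> g p | g. g \<in> carrier G \<and> A \<in> translate \<phi> g p}"

end

theory Submission
  imports Defs
begin

text \<open>
  Everything rests on one fact: for an ultrafilter \<open>p\<close> on \<open>X\<close>, two translates \<open>gp\<close> and \<open>hp\<close>
  coincide only if \<open>gx = hx\<close> for \<open>p\<close>-almost all \<open>x\<close> (\<open>translate_eq_iff_agree\<close>). It turns the
  number of ultrafilters in the companion of \<open>p\<close> into the number of distinct points of \<open>A\<close> that
  finitely many group elements reach from a \<open>p\<close>-typical point.

  Suppose that \<open>A\<close> is not sparse, as witnessed by an infinite \<open>Y \<subseteq> A\<close>, and take a free ultrafilter
  \<open>p\<close> containing \<open>Y\<close>. If the companion of \<open>p\<close> were a finite family \<open>{hp. h \<in> H}\<close>, the choice of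
  \<open>Y\<close> would give a finite \<open>F\<close> such that every \<open>y \<in> Y\<close> is moved by some \<open>f \<in> F\<close> to a point of \<open>A\<close>
  outside \<open>Hy\<close>. A single \<open>f\<close> does this for \<open>p\<close>-almost all \<open>y\<close>; then \<open>A \<in> fp\<close>, so \<open>fp = hp\<close>
  for some \<open>h \<in> H\<close>, although \<open>f\<close> and \<open>h\<close> differ \<open>p\<close>-almost everywhere.

  Conversely, let \<open>g\<^sub>0p, g\<^sub>1p, \<dots>\<close> be distinct members of the companion of a free \<open>p\<close>. For each
  \<open>n\<close>, the points \<open>g\<^sub>0x, \<dots>, g\<^sub>nx\<close> are distinct and lie in \<open>A\<close> for \<open>p\<close>-almost all \<open>x\<close>, so there are
  distinct \<open>x\<^sub>0, x\<^sub>1, \<dots>\<close> such that \<open>x\<^sub>n\<close> has this property for \<open>n\<close>. The set of all \<open>g\<^sub>0x\<^sub>n\<close>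
  violates the condition of sparseness. Indeed, for any finite \<open>H\<close> only the size of \<open>H\<close> matters:
  when \<open>n\<close> exceeds it, the ball of \<open>g\<^sub>0x\<^sub>n\<close> given by \<open>H\<close> is too small to contain all of the
  points \<open>g\<^sub>0x\<^sub>n, \<dots>, g\<^sub>nx\<^sub>n\<close>, and the finitely many other \<open>n\<close> are handled by transitivity.
  In this way a countable set defeats all finite \<open>H\<close>, even when \<open>G\<close> is uncountable.
\<close>

section \<open>Ultrafilters on a set\<close>

lemma ultrafilter_on_subset: "ultrafilter_on X p \<Longrightarrow> P \<in> p \<Longrightarrow> P \<subseteq> X"
  unfolding ultrafilter_on_def by blast

lemma ultrafilter_on_not_empty: "ultrafilter_on X p \<Longrightarrow> P \<in> p \<Longrightarrow> P \<noteq> {}"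
  unfolding ultrafilter_on_def by blast

lemma ultrafilter_on_Int: "ultrafilter_on X p \<Longrightarrow> P \<in> p \<Longrightarrow> Q \<in> p \<Longrightarrow> P \<inter> Q \<in> p"
  unfolding ultrafilter_on_def by blast

lemma ultrafilter_on_mono: "ultrafilter_on X p \<Longrightarrow> P \<in> p \<Longrightarrow> P \<subseteq> Q \<Longrightarrow> Q \<subseteq> X \<Longrightarrow> Q \<in> p"
  unfolding ultrafilter_on_def by blast

lemma ultrafilter_on_Compl: "ultrafilter_on X p \<Longrightarrow> P \<subseteq> X \<Longrightarrow> P \<notin> p \<Longrightarrow> X - P \<in> p"
  unfolding ultrafilter_on_def by blast

lemma ultrafilter_on_UnD:
  assumes p: "ultrafilter_on X p" and "P \<union> Q \<in> p" and "P \<notin> p"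
  shows "Q \<in> p"
proof -
  have PQ: "P \<union> Q \<subseteq> X" using p assms(2) by (rule ultrafilter_on_subset)
  then have "X - P \<in> p" using ultrafilter_on_Compl[OF p _ assms(3)] by simp
  then have "(X - P) \<inter> (P \<union> Q) \<in> p" using assms(2) by (rule ultrafilter_on_Int[OF p])
  then show ?thesis by (rule ultrafilter_on_mono[OF p]) (use PQ in auto)
qed

lemma ultrafilter_on_finite_Ball:
  assumes p: "ultrafilter_on X p" and "finite I"
    and "\<And>i. i \<in> I \<Longrightarrow> {x \<in> X. R i x} \<in> p"
  shows "{x \<in> X. \<forall>i \<in> I. R i x} \<in> p"
  using assms(2,3)
proof (induction I)
  case empty
  then show ?case using p by (simp add: ultrafilter_on_def)
next
  case (insert i I)
  have "{x \<in> X. \<forall>j \<in> insert i I. R j x} = {x \<in> X. R i x} \<inter> {x \<in> X. \<forall>j \<in> I. R j x}"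
    by auto
  then show ?case using insert ultrafilter_on_Int[OF p] by simp
qed

lemma ultrafilter_on_finite_Bex:
  assumes p: "ultrafilter_on X p" and I: "finite I"
    and "{x \<in> X. \<exists>i \<in> I. R i x} \<in> p"
  shows "\<exists>i \<in> I. {x \<in> X. R i x} \<in> p"
proof (rule ccontr)
  assume none: "\<not> ?thesis"
  have "{x \<in> X. \<not> R i x} \<in> p" if "i \<in> I" for i
  proof -
    have "X - {x \<in> X. R i x} = {x \<in> X. \<not> R i x}" by blast
    with that none ultrafilter_on_Compl[OF p, of "{x \<in> X. R i x}"] show ?thesis by auto
  qed
  then have "{x \<in> X. \<forall>i \<in> I. \<not> R i x} \<in> p"
    by (rule ultrafilter_on_finite_Ball[OF p I])
  then have "{x \<in> X. \<forall>i \<in> I. \<not> R i x} \<inter> {x \<in> X. \<exists>i \<in> I. R i x} \<in> p"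
    using assms(3) by (rule ultrafilter_on_Int[OF p])
  then show False
    using ultrafilter_on_not_empty[OF p] by blast
qed

lemma beta_remainder_infinite_member:
  assumes "p \<in> beta_remainder X" and P: "P \<in> p"
  shows "infinite P"
proof
  assume "finite P"
  have p: "ultrafilter_on X p" and np: "p \<notin> principal_ultrafilter X ` X"
    using assms(1) by (auto simp: beta_remainder_def beta_def)
  have PX: "P \<subseteq> X" using p P by (rule ultrafilter_on_subset)
  then have "{x \<in> X. \<exists>a \<in> P. x = a} = P" by blast
  then obtain a where a: "a \<in> P" "{x \<in> X. x = a} \<in> p"
    using ultrafilter_on_finite_Bex[OF p \<open>finite P\<close>, of "\<lambda>a x. x = a"] P by auto
  have "{x \<in> X. x = a} = {a}" using a(1) PX by blast
  with a(2) have single: "{a} \<in> p" by simp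
  have "Q \<in> p \<longleftrightarrow> Q \<in> principal_ultrafilter X a" for Q
  proof -
    have "a \<in> Q" if "Q \<in> p"
      using ultrafilter_on_not_empty[OF p ultrafilter_on_Int[OF p that single]] by blast
    moreover have "Q \<in> p" if "Q \<subseteq> X" "a \<in> Q"
      using ultrafilter_on_mono[OF p single] that by blast
    ultimately show ?thesis
      using ultrafilter_on_subset[OF p] by (auto simp: principal_ultrafilter_def)
  qed
  then have "p = principal_ultrafilter X a" by blast
  with np a(1) PX show False by blast
qed

text \<open>Zorn's lemma is applied to the families all of whose finite intersections meet \<open>Y\<close> in
  an infinite set. This property is of finite character, and a maximal family with it is a free
  ultrafilter: if it contained neither \<open>P\<close> nor \<open>X - P\<close>, some of its finite intersections would meet
  both \<open>Y \<inter> P\<close> and \<open>Y - P\<close> in a finite set.\<close>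

lemma free_ultrafilter_containing:
  assumes "Y \<subseteq> X" and "infinite Y"
  obtains p where "p \<in> beta_remainder X" and "Y \<in> p"
proof -
  define good where "good q \<longleftrightarrow> q \<subseteq> Pow X \<and> (\<forall>S. finite S \<and> S \<subseteq> q \<longrightarrow> infinite (Y \<inter> \<Inter>S))"
    for q :: "'a set set"
  have "\<exists>M \<in> Collect good. \<forall>q \<in> Collect good. M \<subseteq> q \<longrightarrow> q = M"
  proof (rule subset_Zorn_nonempty)
    have "good {}" using assms by (auto simp: good_def)
    then show "Collect good \<noteq> {}" by blast
  next
    fix C assume C: "C \<noteq> {}" "subset.chain (Collect good) C"
    have "infinite (Y \<inter> \<Inter>S)" if S: "finite S" "S \<subseteq> \<Union>C" for S
    proof -
      obtain q where "q \<in> C" "S \<subseteq> q"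
        using finite_subset_Union_chain[OF S C] by blast
      moreover have "good q" using C(2) \<open>q \<in> C\<close> by (auto simp: subset.chain_def)
      ultimately show ?thesis using S(1) by (auto simp: good_def)
    qed
    moreover have "\<Union>C \<subseteq> Pow X"
      using C(2) by (fastforce simp: subset.chain_def good_def)
    ultimately show "\<Union>C \<in> Collect good" by (auto simp: good_def)
  qed
  then obtain M where M: "good M" and max: "\<And>q. good q \<Longrightarrow> M \<subseteq> q \<Longrightarrow> q = M" by blast
  have MX: "M \<subseteq> Pow X" and inf: "\<And>S. finite S \<Longrightarrow> S \<subseteq> M \<Longrightarrow> infinite (Y \<inter> \<Inter>S)"
    using M by (auto simp: good_def)
  have refuted: "\<exists>S. finite S \<and> S \<subseteq> M \<and> finite (Y \<inter> P \<inter> \<Inter>S)" if "P \<subseteq> X" "P \<notin> M" for P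
  proof -
    have "\<not> good (insert P M)" using max[of "insert P M"] that by blast
    then obtain S where S: "finite S" "S \<subseteq> insert P M" "finite (Y \<inter> \<Inter>S)"
      using \<open>P \<subseteq> X\<close> MX unfolding good_def by (metis PowI insert_subset)
    have "Y \<inter> P \<inter> \<Inter>(S - {P}) \<subseteq> Y \<inter> \<Inter>S" by blast
    then have "finite (Y \<inter> P \<inter> \<Inter>(S - {P}))" using S(3) finite_subset by blast
    then show ?thesis using S(1,2) by (intro exI[of _ "S - {P}"]) auto
  qed
  have compl: "P \<in> M \<or> X - P \<in> M" if PX: "P \<subseteq> X" for P
  proof (rule ccontr)
    assume "\<not> (P \<in> M \<or> X - P \<in> M)"
    then have "P \<notin> M" "X - P \<notin> M" by auto
    obtain S where S: "finite S" "S \<subseteq> M" "finite (Y \<inter> P \<inter> \<Inter>S)"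
      using refuted[OF PX \<open>P \<notin> M\<close>] by metis
    obtain T where T: "finite T" "T \<subseteq> M" "finite (Y \<inter> (X - P) \<inter> \<Inter>T)"
      using refuted[OF Diff_subset \<open>X - P \<notin> M\<close>] by metis
    have "Y \<inter> \<Inter>(S \<union> T) \<subseteq> (Y \<inter> P \<inter> \<Inter>S) \<union> (Y \<inter> (X - P) \<inter> \<Inter>T)"
      using assms(1) by blast
    then have "finite (Y \<inter> \<Inter>(S \<union> T))" using S(3) T(3) by (meson finite_Un finite_subset)
    moreover have "infinite (Y \<inter> \<Inter>(S \<union> T))" using S T by (intro inf) auto
    ultimately show False by simp
  qed
  have inf1: "infinite (Y \<inter> P)" if "P \<in> M" for P
    using inf[of "{P}"] that by simp
  have inf2: "infinite (Y \<inter> P \<inter> Q)" if "P \<in> M" "Q \<in> M" for P Q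
    using inf[of "{P, Q}"] that by (simp add: Int_assoc)
  have mono: "Q \<in> M" if "P \<in> M" "P \<subseteq> Q" "Q \<subseteq> X" for P Q
  proof (rule ccontr)
    assume "Q \<notin> M"
    then have "infinite (Y \<inter> P \<inter> (X - Q))" using compl that inf2 by blast
    moreover have "Y \<inter> P \<inter> (X - Q) = {}" using that(2) by blast
    ultimately show False by simp
  qed
  have Int: "P \<inter> Q \<in> M" if PQ: "P \<in> M" "Q \<in> M" for P Q
  proof (rule ccontr)
    assume "P \<inter> Q \<notin> M"
    moreover have "P \<inter> Q \<subseteq> X" using PQ MX by blast
    ultimately have "X - P \<inter> Q \<in> M" using compl by blast
    then have "infinite (Y \<inter> \<Inter>{P, Q, X - P \<inter> Q})" using PQ by (intro inf) auto
    moreover have "Y \<inter> \<Inter>{P, Q, X - P \<inter> Q} = {}" by blast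
    ultimately show False by simp
  qed
  have YM: "Y \<in> M"
    using compl[OF assms(1)] inf1[of "X - Y"] by auto
  have "{} \<notin> M" using inf1[of "{}"] by auto
  then have "ultrafilter_on X M"
    using MX Int mono compl mono[OF YM assms(1) subset_refl]
    by (auto simp: ultrafilter_on_def)
  moreover have "M \<noteq> principal_ultrafilter X x" if "x \<in> X" for x
  proof
    assume "M = principal_ultrafilter X x"
    then have "{x} \<in> M" using that by (simp add: principal_ultrafilter_def)
    then show False using inf1[of "{x}"] by simp
  qed
  ultimately have "M \<in> beta_remainder X" by (auto simp: beta_remainder_def beta_def)
  then show thesis using YM that by blast
qed

section \<open>Coincidence of translates\<close>

text \<open>This is the combinatorial core of Katetov's three-set lemma. A subset \<open>Q\<close> of \<open>D\<close> that is
  maximal with disjoint images cannot be enlarged by a point \<open>x\<close> of \<open>D\<close>, and the only obstacles are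
  \<open>f x \<in> h ` Q\<close> and \<open>h x \<in> f ` Q\<close>.\<close>

lemma maximal_subset_with_disjoint_images:
  assumes "\<And>x. x \<in> D \<Longrightarrow> f x \<noteq> h x"
  obtains Q where "Q \<subseteq> D" and "f ` Q \<inter> h ` Q = {}"
    and "D \<subseteq> {x. x \<in> Q \<or> f x \<in> h ` Q \<or> h x \<in> f ` Q}"
proof -
  define good where "good Q \<longleftrightarrow> Q \<subseteq> D \<and> f ` Q \<inter> h ` Q = {}" for Q
  have "\<exists>M \<in> Collect good. \<forall>Q \<in> Collect good. M \<subseteq> Q \<longrightarrow> Q = M"
  proof (rule subset_Zorn')
    fix C assume C: "subset.chain (Collect good) C"
    have "f a \<noteq> h b" if ab: "a \<in> \<Union>C" "b \<in> \<Union>C" for a b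
    proof -
      obtain K L where "K \<in> C" "L \<in> C" "a \<in> K" "b \<in> L" using ab by blast
      moreover have "K \<subseteq> L \<or> L \<subseteq> K" "good K" "good L"
        using C \<open>K \<in> C\<close> \<open>L \<in> C\<close> by (auto simp: subset_chain_def)
      ultimately show ?thesis unfolding good_def by blast
    qed
    moreover have "\<Union>C \<subseteq> D" using C by (fastforce simp: subset_chain_def good_def)
    ultimately show "\<Union>C \<in> Collect good" by (auto simp: good_def)
  qed
  then obtain Q where Q: "good Q" and max: "\<And>R. good R \<Longrightarrow> Q \<subseteq> R \<Longrightarrow> R = Q" by blast
  show thesis
  proof (rule that)
    show "Q \<subseteq> D" "f ` Q \<inter> h ` Q = {}" using Q by (auto simp: good_def)
  next
    have "x \<in> Q \<or> f x \<in> h ` Q \<or> h x \<in> f ` Q" if x: "x \<in> D" for x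
    proof (rule ccontr)
      assume contr: "\<not> (x \<in> Q \<or> f x \<in> h ` Q \<or> h x \<in> f ` Q)"
      have "good (insert x Q)"
        using Q contr x assms[OF x] unfolding good_def by auto
      then show False using max contr by blast
    qed
    then show "D \<subseteq> {x. x \<in> Q \<or> f x \<in> h ` Q \<or> h x \<in> f ` Q}" by blast
  qed
qed

context group_action
begin

lemma mem_translate_iff:
  assumes p: "ultrafilter_on E p" and g: "g \<in> carrier G"
  shows "Q \<in> translate \<phi> g p \<longleftrightarrow> Q \<subseteq> E \<and> {x \<in> E. \<phi> g x \<in> Q} \<in> p"
proof
  assume "Q \<in> translate \<phi> g p"
  then obtain P where P: "P \<in> p" and Q: "Q = \<phi> g ` P" by (auto simp: translate_def)
  have "P \<subseteq> E" using p P by (rule ultrafilter_on_subset)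
  then have "P \<subseteq> {x \<in> E. \<phi> g x \<in> Q}" using Q by blast
  then have "{x \<in> E. \<phi> g x \<in> Q} \<in> p" by (rule ultrafilter_on_mono[OF p P]) auto
  moreover have "Q \<subseteq> E" using Q \<open>P \<subseteq> E\<close> surj_prop[OF g] by blast
  ultimately show "Q \<subseteq> E \<and> {x \<in> E. \<phi> g x \<in> Q} \<in> p" by blast
next
  assume Q: "Q \<subseteq> E \<and> {x \<in> E. \<phi> g x \<in> Q} \<in> p"
  then have "Q \<subseteq> \<phi> g ` E" using surj_prop[OF g] by simp
  then have "Q = \<phi> g ` {x \<in> E. \<phi> g x \<in> Q}" by auto
  then show "Q \<in> translate \<phi> g p" using Q unfolding translate_def by blast
qed

text \<open>If \<open>g\<close> and \<open>h\<close> differ on a set \<open>D \<in> p\<close>, then \<open>D\<close> is covered by a set \<open>Q\<close> with \<open>gQ \<inter> hQ = {}\<close>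
  and the two sets of those \<open>x\<close> for which \<open>gx \<in> hQ\<close> or \<open>hx \<in> gQ\<close>. When \<open>gp = hp\<close>, any of the three
  sets belonging to \<open>p\<close> forces \<open>Q \<in> p\<close>, and then \<open>gp\<close> contains two disjoint sets.\<close>

lemma translate_eq_iff_agree:
  assumes p: "ultrafilter_on E p" and g: "g \<in> carrier G" and h: "h \<in> carrier G"
  shows "translate \<phi> g p = translate \<phi> h p \<longleftrightarrow> {x \<in> E. \<phi> g x = \<phi> h x} \<in> p"
proof
  assume agree: "{x \<in> E. \<phi> g x = \<phi> h x} \<in> p"
  have "translate \<phi> a p \<subseteq> translate \<phi> b p"
    if ab: "a \<in> carrier G" "b \<in> carrier G" "{x \<in> E. \<phi> a x = \<phi> b x} \<in> p" for a b
  proof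
    fix Q assume "Q \<in> translate \<phi> a p"
    then have Q: "Q \<subseteq> E" "{x \<in> E. \<phi> a x \<in> Q} \<in> p" using mem_translate_iff[OF p] ab by auto
    have "{x \<in> E. \<phi> b x \<in> Q} \<in> p"
      by (rule ultrafilter_on_mono[OF p ultrafilter_on_Int[OF p Q(2) ab(3)]]) auto
    then show "Q \<in> translate \<phi> b p" using mem_translate_iff[OF p ab(2)] Q by blast
  qed
  moreover have "{x \<in> E. \<phi> h x = \<phi> g x} \<in> p"
    using agree by (simp only: eq_commute[of "\<phi> h _"])
  ultimately show "translate \<phi> g p = translate \<phi> h p"
    using g h agree by (intro subset_antisym) blast+
next
  assume eq: "translate \<phi> g p = translate \<phi> h p"
  show "{x \<in> E. \<phi> g x = \<phi> h x} \<in> p"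
  proof (rule ccontr)
    assume "{x \<in> E. \<phi> g x = \<phi> h x} \<notin> p"
    then have D: "E - {x \<in> E. \<phi> g x = \<phi> h x} \<in> p" (is "?D \<in> p")
      using ultrafilter_on_Compl[OF p, of "{x \<in> E. \<phi> g x = \<phi> h x}"] by blast
    have differ: "\<phi> g x \<noteq> \<phi> h x" if "x \<in> ?D" for x using that by blast
    obtain Q where Q: "Q \<subseteq> ?D" "\<phi> g ` Q \<inter> \<phi> h ` Q = {}"
      and cover: "?D \<subseteq> {x. x \<in> Q \<or> \<phi> g x \<in> \<phi> h ` Q \<or> \<phi> h x \<in> \<phi> g ` Q}"
      by (rule maximal_subset_with_disjoint_images[of ?D "\<phi> g" "\<phi> h", OF differ])
    have QE: "Q \<subseteq> E" using Q(1) by blast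
    have pull_back: "Q \<in> p" if b: "b \<in> carrier G" and mem: "\<phi> b ` Q \<in> translate \<phi> b p" for b
    proof -
      have "{x \<in> E. \<phi> b x \<in> \<phi> b ` Q} = Q"
        using QE inj_prop[OF b] by (auto simp: inj_on_def)
      with mem show ?thesis using mem_translate_iff[OF p b] by simp
    qed
    have union: "Q \<union> ({x \<in> E. \<phi> g x \<in> \<phi> h ` Q} \<union> {x \<in> E. \<phi> h x \<in> \<phi> g ` Q}) \<in> p"
      by (rule ultrafilter_on_mono[OF p D]) (use cover QE in auto)
    have gQ: "\<phi> g ` Q \<subseteq> E" and hQ: "\<phi> h ` Q \<subseteq> E"
      using QE surj_prop[OF g] surj_prop[OF h] by blast+
    have "Q \<in> p"
    proof -
      consider "Q \<in> p" | "{x \<in> E. \<phi> g x \<in> \<phi> h ` Q} \<in> p"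
        | "{x \<in> E. \<phi> h x \<in> \<phi> g ` Q} \<in> p"
        using ultrafilter_on_UnD[OF p] union by metis
      then show ?thesis
      proof cases
        case 1
        then show ?thesis .
      next
        case 2
        then have "\<phi> h ` Q \<in> translate \<phi> g p" using hQ mem_translate_iff[OF p g] by simp
        then show ?thesis using pull_back[OF h] eq by simp
      next
        case 3
        then have "\<phi> g ` Q \<in> translate \<phi> h p" using gQ mem_translate_iff[OF p h] by simp
        then show ?thesis using pull_back[OF g] eq by simp
      qed
    qed
    then have "\<phi> g ` Q \<in> translate \<phi> g p" "\<phi> h ` Q \<in> translate \<phi> h p"
      by (auto simp: translate_def)
    then have "{x \<in> E. \<phi> g x \<in> \<phi> g ` Q} \<in> p" "{x \<in> E. \<phi> g x \<in> \<phi> h ` Q} \<in> p"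
      unfolding eq[symmetric] mem_translate_iff[OF p g] by simp_all
    then have "{x \<in> E. \<phi> g x \<in> \<phi> g ` Q} \<inter> {x \<in> E. \<phi> g x \<in> \<phi> h ` Q} \<in> p"
      by (rule ultrafilter_on_Int[OF p])
    then have "{x \<in> E. \<phi> g x \<in> \<phi> g ` Q} \<inter> {x \<in> E. \<phi> g x \<in> \<phi> h ` Q} \<noteq> {}"
      by (rule ultrafilter_on_not_empty[OF p])
    then show False using Q(2) by auto
  qed
qed

section \<open>Finite companions imply sparseness\<close>

lemma sparse_if_finite_ultra_companions:
  assumes A: "A \<subseteq> E"
    and fin: "\<And>p. p \<in> beta_remainder E \<Longrightarrow> finite (ultra_companion G \<phi> p A)"
  shows "sparse G \<phi> A"
proof (rule ccontr)
  assume "\<not> sparse G \<phi> A"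
  then obtain Y where Y: "Y \<subseteq> A" "infinite Y"
    and esc: "\<forall>H \<in> Fpow (carrier G). \<exists>F \<in> Fpow (carrier G). \<forall>y \<in> Y.
      ball_in \<phi> A y F - ball_in \<phi> A y H \<noteq> {}"
    unfolding sparse_def by (simp only: not_all not_imp bex_simps ball_simps) metis
  obtain p where rem: "p \<in> beta_remainder E" and Yp: "Y \<in> p"
    using free_ultrafilter_containing[of Y E] Y A by blast
  have p: "ultrafilter_on E p" using rem by (simp add: beta_remainder_def beta_def)
  define T where "T = {g \<in> carrier G. A \<in> translate \<phi> g p}"
  have "ultra_companion G \<phi> p A = (\<lambda>g. translate \<phi> g p) ` T"
    by (auto simp: ultra_companion_def T_def)
  then have "finite ((\<lambda>g. translate \<phi> g p) ` T)" using fin[OF rem] by simp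
  then obtain H where H: "H \<subseteq> T" "finite H"
      "(\<lambda>g. translate \<phi> g p) ` T = (\<lambda>g. translate \<phi> g p) ` H"
    using finite_subset_image[OF _ subset_refl] by metis
  have "H \<in> Fpow (carrier G)" using H by (auto simp: Fpow_def T_def)
  then obtain F where F: "F \<subseteq> carrier G" "finite F"
    and ne: "\<And>y. y \<in> Y \<Longrightarrow> ball_in \<phi> A y F - ball_in \<phi> A y H \<noteq> {}"
    using esc by (auto simp: Fpow_def)
  have "\<exists>f \<in> F. \<phi> f y \<in> A \<and> (\<forall>h \<in> H. \<phi> f y \<noteq> \<phi> h y)" if "y \<in> Y" for y
    using ne[OF that] by (auto simp: ball_in_def ball_at_def)
  then have "Y \<subseteq> {x \<in> E. \<exists>f \<in> F. \<phi> f x \<in> A \<and> (\<forall>h \<in> H. \<phi> f x \<noteq> \<phi> h x)}"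
    using Y A by blast
  then have "{x \<in> E. \<exists>f \<in> F. \<phi> f x \<in> A \<and> (\<forall>h \<in> H. \<phi> f x \<noteq> \<phi> h x)} \<in> p"
    by (rule ultrafilter_on_mono[OF p Yp]) auto
  then obtain f where f: "f \<in> F" and
    P: "{x \<in> E. \<phi> f x \<in> A \<and> (\<forall>h \<in> H. \<phi> f x \<noteq> \<phi> h x)} \<in> p" (is "?P \<in> p")
    using ultrafilter_on_finite_Bex[OF p F(2),
      of "\<lambda>f x. \<phi> f x \<in> A \<and> (\<forall>h \<in> H. \<phi> f x \<noteq> \<phi> h x)"] by blast
  have fG: "f \<in> carrier G" using f F by blast
  have "{x \<in> E. \<phi> f x \<in> A} \<in> p" by (rule ultrafilter_on_mono[OF p P]) auto
  then have "f \<in> T" using A fG mem_translate_iff[OF p fG] by (simp add: T_def)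
  then obtain h where h: "h \<in> H" "translate \<phi> f p = translate \<phi> h p" using H(3) by blast
  then have "{x \<in> E. \<phi> f x = \<phi> h x} \<in> p"
    using translate_eq_iff_agree[OF p fG] H(1) by (auto simp: T_def)
  then have "?P \<inter> {x \<in> E. \<phi> f x = \<phi> h x} \<in> p" using P ultrafilter_on_Int[OF p] by blast
  then show False using ultrafilter_on_not_empty[OF p] h(1) by blast
qed

end

section \<open>Sparseness implies finite companions\<close>

lemma injective_choice_from_infinite_sets:
  fixes P :: "nat \<Rightarrow> 'a set"
  assumes "\<And>n. infinite (P n)"
  obtains y where "inj y" and "\<And>n. y n \<in> P n"
proof -
  have "\<exists>y. \<forall>n. y n \<in> P n \<and> y n \<notin> y ` {..<n}"
  proof (rule dependent_wellorder_choice)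
    fix r and f g :: "nat \<Rightarrow> 'a" and n :: nat
    assume "\<And>m. m < n \<Longrightarrow> f m = g m"
    then have "f ` {..<n} = g ` {..<n}" by simp
    then show "(r \<in> P n \<and> r \<notin> f ` {..<n}) = (r \<in> P n \<and> r \<notin> g ` {..<n})" by simp
  next
    fix f :: "nat \<Rightarrow> 'a" and n :: nat
    have "infinite (P n - f ` {..<n})" using assms by simp
    then show "\<exists>r. r \<in> P n \<and> r \<notin> f ` {..<n}" using infinite_imp_nonempty by blast
  qed
  then obtain y where y: "\<And>n. y n \<in> P n" "\<And>n. y n \<notin> y ` {..<n}" by blast
  have "inj y"
  proof (rule linorder_injI)
    fix m n :: nat assume "m < n"
    then have "y m \<in> y ` {..<n}" by blast
    then show "y m \<noteq> y n" using y(2)[of n] by metis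
  qed
  with y that show thesis by blast
qed

lemma card_ball_at_le: "finite H \<Longrightarrow> card (ball_at \<phi> x H) \<le> Suc (card H)"
proof -
  assume "finite H"
  then have "card ((\<lambda>g. \<phi> g x) ` H) \<le> card H" by (rule card_image_le)
  then show ?thesis
    using card_Un_le[of "(\<lambda>g. \<phi> g x) ` H" "{x}"] by (simp add: ball_at_def)
qed

lemma finite_ball_at: "finite H \<Longrightarrow> finite (ball_at \<phi> x H)"
  by (simp add: ball_at_def)

context transitive_action
begin

lemma escape_ball:
  assumes "A \<subseteq> E" "infinite A" "finite H" "z \<in> E"
  shows "\<exists>k \<in> carrier G. \<phi> k z \<in> A - ball_at \<phi> z H"
proof -
  have "infinite (A - ball_at \<phi> z H)" using assms finite_ball_at by (metis Diff_infinite_finite)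
  then obtain w where w: "w \<in> A - ball_at \<phi> z H" using infinite_imp_nonempty by blast
  then show ?thesis using unique_orbit[OF assms(4), of w] assms(1) by blast
qed

lemma finite_ultra_companion_if_sparse:
  assumes A: "A \<subseteq> E" and sparse: "sparse G \<phi> A" and rem: "p \<in> beta_remainder E"
  shows "finite (ultra_companion G \<phi> p A)"
proof (rule ccontr)
  assume "infinite (ultra_companion G \<phi> p A)"
  then obtain c :: "nat \<Rightarrow> _" where c: "inj c" "range c \<subseteq> ultra_companion G \<phi> p A"
    using infinite_countable_subset by blast
  have "\<forall>n. \<exists>g. g \<in> carrier G \<and> A \<in> translate \<phi> g p \<and> c n = translate \<phi> g p"
    using c(2) unfolding ultra_companion_def by blast
  then obtain g where gG: "\<And>n. g n \<in> carrier G" and gA: "\<And>n. A \<in> translate \<phi> (g n) p"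
    and cg: "\<And>n. c n = translate \<phi> (g n) p" by metis
  have p: "ultrafilter_on E p" using rem by (simp add: beta_remainder_def beta_def)
  interpret group G using group_hom group_hom.axioms(1) by blast
  define P where
    "P n = {x \<in> E. \<forall>(i, j) \<in> {..n} \<times> {..n}. \<phi> (g i) x \<in> A \<and> (i \<noteq> j \<longrightarrow> \<phi> (g i) x \<noteq> \<phi> (g j) x)}"
    for n
  have "infinite (P n)" for n
  proof -
    have "P n \<in> p" unfolding P_def
    proof (rule ultrafilter_on_finite_Ball[OF p])
      show "finite ({..n} \<times> {..n})" by simp
    next
      fix ij assume "ij \<in> {..n} \<times> {..n}"
      obtain i j where ij: "ij = (i, j)" by fastforce
      have Ai: "{x \<in> E. \<phi> (g i) x \<in> A} \<in> p" using gA gG mem_translate_iff[OF p] by blast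
      have "{x \<in> E. \<phi> (g i) x \<in> A \<and> (i \<noteq> j \<longrightarrow> \<phi> (g i) x \<noteq> \<phi> (g j) x)} \<in> p"
      proof (cases "i = j")
        case True
        then show ?thesis using Ai by simp
      next
        case False
        then have "translate \<phi> (g i) p \<noteq> translate \<phi> (g j) p"
          using c(1) cg by (metis injD)
        then have "{x \<in> E. \<phi> (g i) x = \<phi> (g j) x} \<notin> p"
          using translate_eq_iff_agree[OF p gG gG] by blast
        then have "E - {x \<in> E. \<phi> (g i) x = \<phi> (g j) x} \<in> p"
          by (intro ultrafilter_on_Compl[OF p]) auto
        then have "{x \<in> E. \<phi> (g i) x \<in> A} \<inter> (E - {x \<in> E. \<phi> (g i) x = \<phi> (g j) x}) \<in> p"
          using Ai ultrafilter_on_Int[OF p] by blast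
        then show ?thesis by (rule ultrafilter_on_mono[OF p]) auto
      qed
      then show "{x \<in> E. case ij of (i, j) \<Rightarrow>
          \<phi> (g i) x \<in> A \<and> (i \<noteq> j \<longrightarrow> \<phi> (g i) x \<noteq> \<phi> (g j) x)} \<in> p" by (simp add: ij)
    qed
    then show ?thesis by (rule beta_remainder_infinite_member[OF rem])
  qed
  then obtain x where x: "inj x" and xP: "\<And>n. x n \<in> P n"
    using injective_choice_from_infinite_sets by blast
  have xE: "x n \<in> E" for n using xP[of n] by (simp add: P_def)
  have inA: "\<phi> (g i) (x n) \<in> A" if "i \<le> n" for i n
    using xP[of n] that by (auto simp: P_def)
  have inj: "inj_on (\<lambda>i. \<phi> (g i) (x n)) {..n}" for n
    using xP[of n] by (fastforce simp: P_def inj_on_def)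
  define z where "z n = \<phi> (g 0) (x n)" for n
  have zA: "z n \<in> A" for n using inA[of 0 n] by (simp add: z_def)
  then have zE: "z n \<in> E" for n using A by blast
  have "inj z" using x xE inj_prop[OF gG[of 0]] by (auto simp: z_def inj_def inj_on_def)
  then have infY: "infinite (range z)" using finite_imageD infinite_UNIV_nat by blast
  have infA: "infinite A" using infY zA by (meson finite_subset image_subsetI)
  have "range z \<subseteq> A" using zA by blast
  then have "\<exists>H \<in> Fpow (carrier G). \<forall>F \<in> Fpow (carrier G). \<exists>y \<in> range z.
      ball_in \<phi> A y F - ball_in \<phi> A y H = {}"
    using sparse infY unfolding sparse_def by blast
  then obtain H where H: "H \<subseteq> carrier G" "finite H"
    and close: "\<And>F. F \<subseteq> carrier G \<Longrightarrow> finite F \<Longrightarrow>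
      \<exists>n. ball_in \<phi> A (z n) F - ball_in \<phi> A (z n) H = {}"
    by (auto simp: Fpow_def)
  define m where "m = Suc (card H)"
  obtain k where kG: "\<And>n. k n \<in> carrier G"
    and k: "\<And>n. \<phi> (k n) (z n) \<in> A - ball_at \<phi> (z n) H"
    using escape_ball[OF A infA H(2) zE] by metis
  have gz: "\<phi> (g i \<otimes> inv (g 0)) (z n) = \<phi> (g i) (x n)" for i n
    using composition_rule[OF zE gG inv_closed[OF gG]] orbit_sym_aux[OF gG xE]
    by (simp add: z_def)
  \<comment> \<open>Composing with \<open>inv (g 0)\<close> leads from \<open>z n\<close> back through \<open>x n\<close> to \<open>g i\<close> applied to \<open>x n\<close>. For
    \<open>n < m\<close> these points need not lie in \<open>A\<close> or be distinct, so \<open>k n\<close> is used instead.\<close>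
  define F where "F = (\<lambda>i. g i \<otimes> inv (g 0)) ` {..m} \<union> k ` {..<m}"
  have "F \<subseteq> carrier G" "finite F" using gG kG by (auto simp: F_def)
  then obtain n where n: "ball_in \<phi> A (z n) F - ball_in \<phi> A (z n) H = {}" using close by blast
  have "\<exists>f \<in> F. \<phi> f (z n) \<in> A - ball_at \<phi> (z n) H"
  proof (cases "n < m")
    case True
    then show ?thesis using k[of n] by (intro bexI[of _ "k n"]) (auto simp: F_def)
  next
    case False
    then have "inj_on (\<lambda>i. \<phi> (g i) (x n)) {..m}" using inj[of n] by (auto intro: inj_on_subset)
    \<comment> \<open>The \<open>m + 1 = card H + 2\<close> distinct points do not fit into a ball, which may contain its
      centre in addition to the \<open>card H\<close> images.\<close>
    then have "card ((\<lambda>i. \<phi> (g i) (x n)) ` {..m}) = Suc m" by (simp add: card_image)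
    then have "\<not> (\<lambda>i. \<phi> (g i) (x n)) ` {..m} \<subseteq> ball_at \<phi> (z n) H"
      using card_mono[OF finite_ball_at[OF H(2)]] card_ball_at_le[OF H(2), of \<phi> "z n"]
      unfolding m_def by (metis Suc_n_not_le_n le_trans)
    then obtain i where i: "i \<le> m" "\<phi> (g i) (x n) \<notin> ball_at \<phi> (z n) H" by auto
    then have "\<phi> (g i \<otimes> inv (g 0)) (z n) \<in> A - ball_at \<phi> (z n) H"
      using gz inA[of i n] False by simp
    then show ?thesis using i(1) by (auto simp: F_def)
  qed
  then show False using n by (auto simp: ball_in_def ball_at_def)
qed

end

theorem proposition5p1:
  fixes G :: "('g, 'm) monoid_scheme" and X :: "'x set" and \<phi> :: "'g \<Rightarrow> 'x \<Rightarrow> 'x"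
    and A :: "'x set"
  assumes "transitive_action G X \<phi>"
    and "infinite X"
    and "A \<subseteq> X"
  shows "sparse G \<phi> A \<longleftrightarrow> (\<forall>p \<in> beta_remainder X. finite (ultra_companion G \<phi> p A))"
proof -
  interpret transitive_action G X \<phi> by (rule assms(1))
  show ?thesis
    using sparse_if_finite_ultra_companions finite_ultra_companion_if_sparse assms(3) by blast
qed

end
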